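(* Let $k \in K_{ad}$ be an arbitrary design, let $u(k) \in \mathcal{H}$ be the true solution of the underlying boundary value problem, i.e. $a_k(u(k),v) = \ell(v)$ for all $v \in \mathcal{H}$, and let $u_h(k) \in \mathcal{H}_h$ be its finite element approximation, i.e. $a_k(u_h(k),v_h) = \ell(v_h)$ for all $v_h \in \mathcal{H}_h$. Then $$\ell(u(k)) = \ell(u_h(k)) + \|u(k) - u_h(k)\|_a^2,$$ or, equivalently, in terms of the true cost functional $\Phi(k) = \ell(u(k))$ and the discrete cost functional $\Phi_h(k) = \ell(u_h(k))$, $$\Phi(k) = \Phi_h(k) + \|u(k) - u_h(k)\|_a^2.$$
   Context: $\Omega \subset \mathbb{R}^2$ is a polygonal Lipschitz domain with boundary $\partial\Omega = \overline{\Gamma_u \cup \Gamma_n}$, $\Gamma_u \cap \Gamma_n = \emptyset$. The solution space is $\mathcal{H} = \{u \in H^1(\Omega) : u = 0 \text{ on } \Gamma_u\}$. The set of admissible designs is $$K_{ad} = \Big\{k \in L^\infty(\Omega) : \gamma \le k \le 1 \text{ a.e. in } \Omega,\ \int_\Omega k = \mathbf{V}\Big\},$$ where $0 < \gamma \ll 1$ and $\mathbf{V}$ is a fixed volume constraint. For each $k \in K_{ad}$, $a_k(\cdot,\cdot) : \mathcal{H}\times\mathcal{H} \to \mathbb{R}$ is a coercive symmetric continuous bilinear form associated with $k$, and $\ell : \mathcal{H} \to \mathbb{R}$ is a bounded linear form. (In the heat conduction model problem, $a_k(u,v) = \int_\Omega k^p\, \nabla u\cdot\nabla v$ with $p \ge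 1$ and $\ell(v) = \int_\Omega f v$ with $f \in L_2(\Omega)$; the result is formulated for general forms.) The energy norm is $\|v\|_a = a_k(v,v)^{1/2}$. $\mathcal{H}_h \subset \mathcal{H}$ is a finite element subspace, i.e. a finite-dimensional linear subspace of $\mathcal{H}$. *)

theory Defs
  imports "HOL-Analysis.Analysis"
begin

text \<open>
  Elements of \<open>L\<^sup>2\<close>, \<open>L\<^sup>\<infinity>\<close> and \<open>H\<^sup>1\<close> are represented by functions on the whole plane, of which
  only the values on \<open>\<Omega>\<close>, up to a null set, are relevant: all norms below are integrals over \<open>\<Omega>\<close>,
  so bounded forms do not distinguish functions that agree almost everywhere on \<open>\<Omega>\<close>.
\<close>

type_synonym point = "real ^ 2"
type_synonym field2 = "real ^ 2 \<Rightarrow> real"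

text \<open>Near each boundary point, and in suitable orthonormal coordinates, a Lipschitz domain is
  the region strictly above the graph of a Lipschitz function.\<close>

definition lipschitz_domain :: "point set \<Rightarrow> bool" where
  "lipschitz_domain \<Omega> \<longleftrightarrow>
     open \<Omega> \<and> connected \<Omega> \<and> bounded \<Omega> \<and> \<Omega> \<noteq> {} \<and>
     (\<forall>p \<in> frontier \<Omega>. \<exists>e1 e2 r L. \<exists>\<phi> :: real \<Rightarrow> real.
        norm e1 = 1 \<and> norm e2 = 1 \<and> e1 \<bullet> e2 = 0 \<and> r > 0 \<and> L-lipschitz_on UNIV \<phi> \<and>
        (\<forall>x \<in> ball p r. x \<in> \<Omega> \<longleftrightarrow> \<phi> ((x - p) \<bullet> e1) < (x - p) \<bullet> e2))"

definition polygonal_boundary :: "point set \<Rightarrow> bool" where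
  "polygonal_boundary \<Omega> \<longleftrightarrow>
     (\<exists>E. finite E \<and> frontier \<Omega> = (\<Union>(p, q) \<in> E. closed_segment p q))"

definition partial :: "2 \<Rightarrow> field2 \<Rightarrow> field2" where
  "partial i f x = frechet_derivative f (at x) (axis i 1)"

definition grad :: "field2 \<Rightarrow> point \<Rightarrow> point" where
  "grad f x = (\<chi> i. partial i f x)"

primrec times_differentiable :: "nat \<Rightarrow> field2 \<Rightarrow> bool" where
  "times_differentiable 0 f \<longleftrightarrow> continuous_on UNIV f"
| "times_differentiable (Suc n) f \<longleftrightarrow>
     f differentiable_on UNIV \<and> (\<forall>i. times_differentiable n (partial i f))"

definition smooth :: "field2 \<Rightarrow> bool" where
  "smooth f \<longleftrightarrow> (\<forall>n. times_differentiable n f)"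

definition test_function :: "point set \<Rightarrow> field2 \<Rightarrow> bool" where
  "test_function \<Omega> \<phi> \<longleftrightarrow>
     smooth \<phi> \<and> compact (closure {x. \<phi> x \<noteq> 0}) \<and> closure {x. \<phi> x \<noteq> 0} \<subseteq> \<Omega>"

definition L2 :: "point measure \<Rightarrow> (point \<Rightarrow> 'b::euclidean_space) set" where
  "L2 M = {f \<in> borel_measurable M. integrable M (\<lambda>x. (norm (f x))\<^sup>2)}"

definition Linf :: "point measure \<Rightarrow> field2 set" where
  "Linf M = {f \<in> borel_measurable M. \<exists>C. AE x in M. \<bar>f x\<bar> \<le> C}"

definition tendsto_L2 ::
  "point measure \<Rightarrow> (nat \<Rightarrow> point \<Rightarrow> 'b::euclidean_space) \<Rightarrow> (point \<Rightarrow> 'b) \<Rightarrow> bool" where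
  "tendsto_L2 M f g \<longleftrightarrow>
     (\<lambda>n. \<integral>\<^sup>+x. ennreal ((norm (f n x - g x))\<^sup>2) \<partial>M) \<longlonglongrightarrow> 0"

definition weak_gradient :: "point set \<Rightarrow> field2 \<Rightarrow> (point \<Rightarrow> point) \<Rightarrow> bool" where
  "weak_gradient \<Omega> u g \<longleftrightarrow>
     g \<in> L2 (lebesgue_on \<Omega>) \<and>
     (\<forall>\<phi>. test_function \<Omega> \<phi> \<longrightarrow>
       (\<forall>i. (LINT x|lebesgue_on \<Omega>. u x * partial i \<phi> x)
             = - (LINT x|lebesgue_on \<Omega>. g x $ i * \<phi> x)))"

definition H1 :: "point set \<Rightarrow> field2 set" where
  "H1 \<Omega> = {u \<in> L2 (lebesgue_on \<Omega>). \<exists>g. weak_gradient \<Omega> u g}"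

text \<open>Weak gradients are unique up to null sets, so the choice below does not matter.\<close>

definition H1_norm :: "point set \<Rightarrow> field2 \<Rightarrow> real" where
  "H1_norm \<Omega> u =
     sqrt ((LINT x|lebesgue_on \<Omega>. (u x)\<^sup>2)
         + (LINT x|lebesgue_on \<Omega>. (norm ((SOME g. weak_gradient \<Omega> u g) x))\<^sup>2))"

text \<open>One-dimensional Hausdorff measure. The function \<open>diameter\<close> is meaningful
  for bounded sets only, and is \<open>0\<close> for the empty set. The outer measure is countably additive
  on Borel sets (a classical fact, not proved here), so \<open>measure_of\<close> does not fall back to zero.\<close>

definition hausdorff_outer1 :: "point set \<Rightarrow> ennreal" where
  "hausdorff_outer1 A =
     (SUP \<delta> \<in> {0::real<..}.
        INF C \<in> {C :: nat \<Rightarrow> point set.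
                   A \<subseteq> (\<Union>n. C n) \<and> (\<forall>n. bounded (C n) \<and> diameter (C n) \<le> \<delta>)}.
          (\<Sum>n. ennreal (diameter (C n))))"

definition boundary_measure :: "point set \<Rightarrow> point measure" where
  "boundary_measure \<Omega> =
     restrict_space (measure_of UNIV (sets borel) hausdorff_outer1) (frontier \<Omega>)"

text \<open>The trace operator is the continuous extension to \<open>H\<^sup>1(\<Omega>)\<close> of the restriction of smooth
  functions to the boundary; its graph is obtained by taking limits in \<open>H\<^sup>1(\<Omega>)\<close> and in
  \<open>L\<^sup>2\<close> of the boundary.\<close>

definition has_trace :: "point set \<Rightarrow> field2 \<Rightarrow> field2 \<Rightarrow> bool" where
  "has_trace \<Omega> u t \<longleftrightarrow>
     t \<in> L2 (boundary_measure \<Omega>) \<and>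
     (\<exists>\<phi> g. (\<forall>n. smooth (\<phi> n)) \<and> weak_gradient \<Omega> u g \<and>
        tendsto_L2 (lebesgue_on \<Omega>) \<phi> u \<and>
        tendsto_L2 (lebesgue_on \<Omega>) (\<lambda>n. grad (\<phi> n)) g \<and>
        tendsto_L2 (boundary_measure \<Omega>) \<phi> t)"

definition state_space :: "point set \<Rightarrow> point set \<Rightarrow> field2 set" where
  "state_space \<Omega> \<Gamma>u =
     {u \<in> H1 \<Omega>. \<exists>t. has_trace \<Omega> u t \<and> (AE x in boundary_measure \<Omega>. x \<in> \<Gamma>u \<longrightarrow> t x = 0)}"

definition admissible_designs :: "point set \<Rightarrow> real \<Rightarrow> real \<Rightarrow> field2 set" where
  "admissible_designs \<Omega> \<gamma> V =
     {k \<in> Linf (lebesgue_on \<Omega>).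
        (AE x in lebesgue_on \<Omega>. \<gamma> \<le> k x \<and> k x \<le> 1) \<and> (LINT x|lebesgue_on \<Omega>. k x) = V}"

definition linear_subspace :: "field2 set \<Rightarrow> bool" where
  "linear_subspace S \<longleftrightarrow>
     (\<lambda>x. 0) \<in> S \<and> (\<forall>u \<in> S. \<forall>v \<in> S. \<forall>c d. (\<lambda>x. c * u x + d * v x) \<in> S)"

text \<open>Finite dimension is meant modulo equality almost everywhere.\<close>

definition finite_dimensional_subspace :: "point set \<Rightarrow> field2 set \<Rightarrow> field2 set \<Rightarrow> bool" where
  "finite_dimensional_subspace \<Omega> H S \<longleftrightarrow>
     S \<subseteq> H \<and> linear_subspace S \<and>
     (\<exists>B. finite B \<and> B \<subseteq> S \<and>
        (\<forall>v \<in> S. \<exists>c. AE x in lebesgue_on \<Omega>. v x = (\<Sum>b\<in>B. c b * b x)))"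

definition linear_form_on :: "field2 set \<Rightarrow> (field2 \<Rightarrow> real) \<Rightarrow> bool" where
  "linear_form_on S l \<longleftrightarrow>
     (\<forall>u \<in> S. \<forall>v \<in> S. \<forall>c d. l (\<lambda>x. c * u x + d * v x) = c * l u + d * l v)"

definition bounded_linear_form :: "point set \<Rightarrow> field2 set \<Rightarrow> (field2 \<Rightarrow> real) \<Rightarrow> bool" where
  "bounded_linear_form \<Omega> S l \<longleftrightarrow>
     linear_form_on S l \<and> (\<exists>C. \<forall>v \<in> S. \<bar>l v\<bar> \<le> C * H1_norm \<Omega> v)"

definition bilinear_form_on :: "field2 set \<Rightarrow> (field2 \<Rightarrow> field2 \<Rightarrow> real) \<Rightarrow> bool" where
  "bilinear_form_on S b \<longleftrightarrow>
     (\<forall>w \<in> S. linear_form_on S (\<lambda>v. b w v) \<and> linear_form_on S (\<lambda>v. b v w))"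

definition symmetric_form_on :: "field2 set \<Rightarrow> (field2 \<Rightarrow> field2 \<Rightarrow> real) \<Rightarrow> bool" where
  "symmetric_form_on S b \<longleftrightarrow> (\<forall>u \<in> S. \<forall>v \<in> S. b u v = b v u)"

definition continuous_form_on ::
  "point set \<Rightarrow> field2 set \<Rightarrow> (field2 \<Rightarrow> field2 \<Rightarrow> real) \<Rightarrow> bool" where
  "continuous_form_on \<Omega> S b \<longleftrightarrow>
     (\<exists>C. \<forall>u \<in> S. \<forall>v \<in> S. \<bar>b u v\<bar> \<le> C * H1_norm \<Omega> u * H1_norm \<Omega> v)"

definition coercive_form_on ::
  "point set \<Rightarrow> field2 set \<Rightarrow> (field2 \<Rightarrow> field2 \<Rightarrow> real) \<Rightarrow> bool" where
  "coercive_form_on \<Omega> S b \<longleftrightarrow> (\<exists>\<alpha>>0. \<forall>v \<in> S. \<alpha> * (H1_norm \<Omega> v)\<^sup>2 \<le> b v v)"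

definition energy_norm :: "(field2 \<Rightarrow> field2 \<Rightarrow> real) \<Rightarrow> field2 \<Rightarrow> real" where
  "energy_norm b v = sqrt (b v v)"

definition variational_solution ::
  "field2 set \<Rightarrow> (field2 \<Rightarrow> field2 \<Rightarrow> real) \<Rightarrow> (field2 \<Rightarrow> real) \<Rightarrow> field2 \<Rightarrow> bool" where
  "variational_solution S b l u \<longleftrightarrow> u \<in> S \<and> (\<forall>v \<in> S. b u v = l v)"

text \<open>The true cost is obtained from the full solution space, the discrete one from the finite
  element space. For coercive bounded forms the solution is unique up to null sets, and the cost
  is independent of the chosen representative.\<close>

definition cost_functional ::
  "field2 set \<Rightarrow> (field2 \<Rightarrow> field2 \<Rightarrow> field2 \<Rightarrow> real) \<Rightarrow> (field2 \<Rightarrow> real) \<Rightarrow> field2 \<Rightarrow> real" where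
  "cost_functional S a l k = l (SOME u. variational_solution S (a k) l u)"

end

theory Submission
  imports Defs
begin

text \<open>
  By symmetry and Galerkin orthogonality, the energy of the error \<open>e = u - uh\<close> is
  \<open>a(e, e) = a(u, u) - 2 a(u, uh) + a(uh, uh) = l u - 2 l uh + l uh\<close>.
  Expanding \<open>a(e, e)\<close> requires \<open>e\<close> to lie in the solution space, whose linearity amounts to
  that of weak gradients and traces. Symmetry also makes the load of a solution
  independent of the solution: \<open>l u' = a(u, u') = a(u', u) = l u\<close>.
\<close>

section \<open>Square integrable functions\<close>

text \<open>The triangle inequality is followed by \<open>(p + q)^2 <= 2 * p^2 + 2 * q^2\<close>,
  whose two sides differ by \<open>(p - q)^2\<close>. The bound serves twice: for integrability of
  squares in \<open>L2\<close> and for limits in \<open>tendsto_L2\<close>.\<close>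

lemma norm_lincomb_power2_le:
  fixes x y :: "'a::real_normed_vector"
  shows "(norm (c *\<^sub>R x + d *\<^sub>R y))\<^sup>2 \<le> 2 * c\<^sup>2 * (norm x)\<^sup>2 + 2 * d\<^sup>2 * (norm y)\<^sup>2"
proof -
  have "norm (c *\<^sub>R x + d *\<^sub>R y) \<le> \<bar>c\<bar> * norm x + \<bar>d\<bar> * norm y"
    using norm_triangle_ineq[of "c *\<^sub>R x" "d *\<^sub>R y"] by simp
  then have "(norm (c *\<^sub>R x + d *\<^sub>R y))\<^sup>2 \<le> (\<bar>c\<bar> * norm x + \<bar>d\<bar> * norm y)\<^sup>2"
    by (intro power_mono) auto
  also have "\<dots> \<le> 2 * (\<bar>c\<bar> * norm x)\<^sup>2 + 2 * (\<bar>d\<bar> * norm y)\<^sup>2"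
    using zero_le_power2[of "\<bar>c\<bar> * norm x - \<bar>d\<bar> * norm y"]
    by (simp add: power2_sum power2_diff)
  finally show ?thesis
    by (simp add: power_mult_distrib)
qed

lemma L2_lincomb:
  assumes "f \<in> L2 M" "g \<in> L2 M"
  shows "(\<lambda>x. c *\<^sub>R f x + d *\<^sub>R g x) \<in> L2 M"
proof -
  have [measurable]: "f \<in> borel_measurable M" "g \<in> borel_measurable M"
    and "integrable M (\<lambda>x. (norm (f x))\<^sup>2)" "integrable M (\<lambda>x. (norm (g x))\<^sup>2)"
    using assms by (auto simp: L2_def)
  then have "integrable M (\<lambda>x. 2 * c\<^sup>2 * (norm (f x))\<^sup>2 + 2 * d\<^sup>2 * (norm (g x))\<^sup>2)"
    by (intro Bochner_Integration.integrable_add integrable_mult_right)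
  then have "integrable M (\<lambda>x. (norm (c *\<^sub>R f x + d *\<^sub>R g x))\<^sup>2)"
    by (rule Bochner_Integration.integrable_bound)
       (auto intro!: AE_I2 order_trans[OF norm_lincomb_power2_le])
  then show ?thesis
    by (simp add: L2_def)
qed

text \<open>Young's inequality bounds the product by the sum of the squares, so a crude integrable
  majorant is enough. The lemma justifies splitting the integrals that define weak
  gradients.\<close>

lemma integrable_mult_L2:
  fixes f g :: field2
  assumes "f \<in> L2 M" "g \<in> L2 M"
  shows "integrable M (\<lambda>x. f x * g x)"
proof -
  have [measurable]: "f \<in> borel_measurable M" "g \<in> borel_measurable M"
    and "integrable M (\<lambda>x. (f x)\<^sup>2)" "integrable M (\<lambda>x. (g x)\<^sup>2)"
    using assms by (auto simp: L2_def)
  then have "integrable M (\<lambda>x. (f x)\<^sup>2 + (g x)\<^sup>2)"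
    by simp
  moreover have "\<bar>f x * g x\<bar> \<le> (f x)\<^sup>2 + (g x)\<^sup>2" for x
  proof -
    have "2 * \<bar>f x * g x\<bar> \<le> (f x)\<^sup>2 + (g x)\<^sup>2"
      using zero_le_power2[of "\<bar>f x\<bar> - \<bar>g x\<bar>"] by (simp add: power2_diff abs_mult)
    then show ?thesis by linarith
  qed
  ultimately show ?thesis
    by (elim Bochner_Integration.integrable_bound) auto
qed

lemma L2_vec_nth:
  fixes g :: "point \<Rightarrow> point"
  assumes "g \<in> L2 M"
  shows "(\<lambda>x. g x $ i) \<in> L2 M"
proof -
  have [measurable]: "g \<in> borel_measurable M" and int: "integrable M (\<lambda>x. (norm (g x))\<^sup>2)"
    using assms by (auto simp: L2_def)
  have [measurable]: "(\<lambda>x. g x $ i) \<in> borel_measurable M"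
    \<comment> \<open>A coordinate is the inner product with a fixed axis vector, which reduces its
      measurability to that of \<open>g\<close>.\<close>
    unfolding cart_eq_inner_axis by measurable
  have "(g x $ i)\<^sup>2 \<le> (norm (g x))\<^sup>2" for x
    using component_le_norm_cart[of "g x" i] abs_le_square_iff[of "g x $ i" "norm (g x)"]
    by simp
  with int have "integrable M (\<lambda>x. (g x $ i)\<^sup>2)"
    by (elim Bochner_Integration.integrable_bound) auto
  then show ?thesis
    by (simp add: L2_def)
qed

text \<open>A continuous function is bounded on the compact closure of \<open>\<Omega>\<close>, and
  \<open>\<Omega>\<close> has finite measure. This puts test functions and their partial derivatives
  into \<open>L2\<close>.\<close>

lemma continuous_L2_lebesgue_on:
  fixes f :: field2
  assumes "open \<Omega>" "bounded \<Omega>" "continuous_on UNIV f"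
  shows "f \<in> L2 (lebesgue_on \<Omega>)"
proof -
  have "\<Omega> \<in> lmeasurable"
    using assms by (simp add: lmeasurable_open)
  then interpret finite_measure "lebesgue_on \<Omega>"
    by (rule finite_measure_lebesgue_on)
  have "f \<in> borel_measurable lborel"
    using borel_measurable_continuous_onI[OF assms(3)] by simp
  then have [measurable]: "f \<in> borel_measurable (lebesgue_on \<Omega>)"
    by (intro measurable_restrict_space1 measurable_completion)
  have "compact (f ` closure \<Omega>)"
    using assms(2) continuous_on_subset[OF assms(3)]
    by (intro compact_continuous_image) auto
  then have "bounded (f ` closure \<Omega>)"
    by (rule compact_imp_bounded)
  then obtain B where B: "\<And>y. y \<in> f ` closure \<Omega> \<Longrightarrow> norm y \<le> B"
    unfolding bounded_iff by blast
  have "norm ((norm (f x))\<^sup>2) \<le> B\<^sup>2" if "x \<in> \<Omega>" for x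
  proof -
    have "norm (f x) \<le> B"
      using B that closure_subset by blast
    then have "(norm (f x))\<^sup>2 \<le> B\<^sup>2"
      by (intro power_mono) auto
    then show ?thesis
      by simp
  qed
  then have "integrable (lebesgue_on \<Omega>) (\<lambda>x. (norm (f x))\<^sup>2)"
    by (intro integrable_const_bound[where B="B\<^sup>2"] AE_I2) (auto simp: space_restrict_space)
  then show ?thesis
    by (simp add: L2_def)
qed

text \<open>The squared error of the combination is bounded pointwise by a combination of the two
  squared errors; integrating and squeezing gives the limit. The measurability assumptions allow the
  nonnegative integral of the bound to be split.\<close>

lemma tendsto_L2_lincomb:
  assumes meas: "\<And>n. f n \<in> borel_measurable M" "\<And>n. f' n \<in> borel_measurable M"
      "g \<in> borel_measurable M" "g' \<in> borel_measurable M"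
    and lim: "tendsto_L2 M f g" "tendsto_L2 M f' g'"
  shows "tendsto_L2 M (\<lambda>n x. c *\<^sub>R f n x + d *\<^sub>R f' n x) (\<lambda>x. c *\<^sub>R g x + d *\<^sub>R g' x)"
proof -
  note [measurable] = meas
  let ?I = "\<lambda>n. \<integral>\<^sup>+x. ennreal ((norm (f n x - g x))\<^sup>2) \<partial>M"
  let ?J = "\<lambda>n. \<integral>\<^sup>+x. ennreal ((norm (f' n x - g' x))\<^sup>2) \<partial>M"
  let ?K = "\<lambda>n. \<integral>\<^sup>+x. ennreal ((norm (c *\<^sub>R f n x + d *\<^sub>R f' n x - (c *\<^sub>R g x + d *\<^sub>R g' x)))\<^sup>2) \<partial>M"
  have le: "?K n \<le> ennreal (2 * c\<^sup>2) * ?I n + ennreal (2 * d\<^sup>2) * ?J n" for n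
  proof -
    have "?K n \<le> (\<integral>\<^sup>+x. ennreal (2 * c\<^sup>2) * ennreal ((norm (f n x - g x))\<^sup>2)
                     + ennreal (2 * d\<^sup>2) * ennreal ((norm (f' n x - g' x))\<^sup>2) \<partial>M)"
    proof (rule nn_integral_mono)
      fix x
      have "c *\<^sub>R f n x + d *\<^sub>R f' n x - (c *\<^sub>R g x + d *\<^sub>R g' x)
          = c *\<^sub>R (f n x - g x) + d *\<^sub>R (f' n x - g' x)"
        by (simp add: algebra_simps)
      then show "ennreal ((norm (c *\<^sub>R f n x + d *\<^sub>R f' n x - (c *\<^sub>R g x + d *\<^sub>R g' x)))\<^sup>2)
          \<le> ennreal (2 * c\<^sup>2) * ennreal ((norm (f n x - g x))\<^sup>2)
            + ennreal (2 * d\<^sup>2) * ennreal ((norm (f' n x - g' x))\<^sup>2)"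
        using norm_lincomb_power2_le[of c "f n x - g x" d "f' n x - g' x"]
        by (simp add: ennreal_leI flip: ennreal_mult ennreal_plus)
    qed
    also have "\<dots> = ennreal (2 * c\<^sup>2) * ?I n + ennreal (2 * d\<^sup>2) * ?J n"
      by (simp add: nn_integral_add nn_integral_cmult)
    finally show ?thesis .
  qed
  have "(\<lambda>n. ennreal (2 * c\<^sup>2) * ?I n + ennreal (2 * d\<^sup>2) * ?J n) \<longlonglongrightarrow>
      ennreal (2 * c\<^sup>2) * 0 + ennreal (2 * d\<^sup>2) * 0"
    using lim unfolding tendsto_L2_def
    by (intro tendsto_add ennreal_tendsto_cmult) auto
  then have "?K \<longlonglongrightarrow> 0"
    using le by (intro tendsto_sandwich[OF _ _ tendsto_const, of 0 ?K]) auto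
  then show ?thesis
    by (simp add: tendsto_L2_def)
qed

section \<open>Smooth functions and weak gradients\<close>

text \<open>\<open>frechet_derivative\<close> is a choice that is pinned down only at points of
  differentiability, so linearity is claimed for differentiable functions.\<close>

lemma partial_lincomb:
  assumes "f differentiable_on UNIV" "g differentiable_on UNIV"
  shows "partial i (\<lambda>x. c * f x + d * g x) = (\<lambda>x. c * partial i f x + d * partial i g x)"
proof
  fix x
  have "(f has_derivative frechet_derivative f (at x)) (at x)"
    "(g has_derivative frechet_derivative g (at x)) (at x)"
    using assms by (auto simp: differentiable_on_def frechet_derivative_works)
  then have "((\<lambda>x. c * f x + d * g x) has_derivative
      (\<lambda>h. c * frechet_derivative f (at x) h + d * frechet_derivative g (at x) h)) (at x)"
    by (auto intro!: derivative_eq_intros)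
  from frechet_derivative_at[OF this, symmetric]
  show "partial i (\<lambda>x. c * f x + d * g x) x = c * partial i f x + d * partial i g x"
    by (simp add: partial_def)
qed

lemma times_differentiable_lincomb:
  "times_differentiable n f \<Longrightarrow> times_differentiable n g \<Longrightarrow>
   times_differentiable n (\<lambda>x. c * f x + d * g x)"
proof (induction n arbitrary: f g)
  case 0
  then show ?case
    by (simp add: continuous_on_add continuous_on_mult_left)
next
  case (Suc n)
  then have "(\<lambda>x. c * f x + d * g x) differentiable_on UNIV"
    by (simp add: differentiable_on_add differentiable_on_mult differentiable_on_const)
  with Suc show ?case
    by (simp add: partial_lincomb)
qed

lemma smooth_lincomb: "smooth f \<Longrightarrow> smooth g \<Longrightarrow> smooth (\<lambda>x. c * f x + d * g x)"
  by (simp add: smooth_def times_differentiable_lincomb)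

lemma smooth_differentiable: "smooth f \<Longrightarrow> f differentiable_on UNIV"
  unfolding smooth_def by (metis times_differentiable.simps(2))

lemma smooth_continuous: "smooth f \<Longrightarrow> continuous_on UNIV f"
  unfolding smooth_def by (metis times_differentiable.simps(1))

lemma smooth_partial: "smooth f \<Longrightarrow> smooth (partial i f)"
  unfolding smooth_def by (metis times_differentiable.simps(2))

lemma grad_lincomb:
  assumes "smooth f" "smooth g"
  shows "grad (\<lambda>x. c * f x + d * g x) = (\<lambda>x. c *\<^sub>R grad f x + d *\<^sub>R grad g x)"
  using assms by (auto simp: fun_eq_iff grad_def vec_eq_iff partial_lincomb smooth_differentiable)

lemma continuous_on_grad: "smooth f \<Longrightarrow> continuous_on UNIV (grad f)"
  unfolding grad_def
  by (intro continuous_on_vec_lambda smooth_continuous smooth_partial)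

text \<open>The defining identity is linear in the pair of function and gradient once its integrals
  may be split. Every integrand is a product of two \<open>L2\<close> functions on the bounded open
  set \<open>\<Omega>\<close>, hence integrable.\<close>

lemma weak_gradient_lincomb:
  assumes \<Omega>: "open \<Omega>" "bounded \<Omega>"
    and u: "u \<in> L2 (lebesgue_on \<Omega>)" "weak_gradient \<Omega> u g"
    and v: "v \<in> L2 (lebesgue_on \<Omega>)" "weak_gradient \<Omega> v h"
  shows "weak_gradient \<Omega> (\<lambda>x. c * u x + d * v x) (\<lambda>x. c *\<^sub>R g x + d *\<^sub>R h x)"
  unfolding weak_gradient_def
proof (intro conjI allI impI)
  have L2: "g \<in> L2 (lebesgue_on \<Omega>)" "h \<in> L2 (lebesgue_on \<Omega>)"
    using u v by (auto simp: weak_gradient_def)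
  then show "(\<lambda>x. c *\<^sub>R g x + d *\<^sub>R h x) \<in> L2 (lebesgue_on \<Omega>)"
    by (rule L2_lincomb)
  fix \<phi> i assume \<phi>: "test_function \<Omega> \<phi>"
  then have "\<phi> \<in> L2 (lebesgue_on \<Omega>)" "partial i \<phi> \<in> L2 (lebesgue_on \<Omega>)"
    using \<Omega> by (auto simp: test_function_def smooth_continuous smooth_partial
        intro!: continuous_L2_lebesgue_on)
  \<comment> \<open>The functions \<open>u\<close> and \<open>v\<close> are paired with the partial
    derivative of \<open>\<phi>\<close>, the components of \<open>g\<close> and \<open>h\<close>
    with \<open>\<phi>\<close> itself.\<close>
  note int = integrable_mult_L2[OF u(1) this(2)] integrable_mult_L2[OF v(1) this(2)]
    integrable_mult_L2[OF L2_vec_nth[OF L2(1)] this(1)]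
    integrable_mult_L2[OF L2_vec_nth[OF L2(2)] this(1)]
  have "(LINT x|lebesgue_on \<Omega>. (c * u x + d * v x) * partial i \<phi> x)
      = c * (LINT x|lebesgue_on \<Omega>. u x * partial i \<phi> x)
        + d * (LINT x|lebesgue_on \<Omega>. v x * partial i \<phi> x)"
    using int by (simp add: distrib_right mult.assoc)
  also have "\<dots> = - (c * (LINT x|lebesgue_on \<Omega>. g x $ i * \<phi> x)
        + d * (LINT x|lebesgue_on \<Omega>. h x $ i * \<phi> x))"
    using u v \<phi> by (simp add: weak_gradient_def)
  also have "\<dots> = - (LINT x|lebesgue_on \<Omega>. (c *\<^sub>R g x + d *\<^sub>R h x) $ i * \<phi> x)"
    using int by (simp add: distrib_right mult.assoc)
  finally show "(LINT x|lebesgue_on \<Omega>. (c * u x + d * v x) * partial i \<phi> x)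
      = - (LINT x|lebesgue_on \<Omega>. (c *\<^sub>R g x + d *\<^sub>R h x) $ i * \<phi> x)" .
qed

section \<open>Traces and the solution space\<close>

lemma continuous_borel_measurable_lebesgue_on:
  fixes f :: "point \<Rightarrow> 'b::euclidean_space"
  shows "continuous_on UNIV f \<Longrightarrow> f \<in> borel_measurable (lebesgue_on \<Omega>)"
  by (intro measurable_restrict_space1 measurable_completion)
     (simp add: borel_measurable_continuous_onI)

lemma continuous_borel_measurable_boundary_measure:
  assumes "continuous_on UNIV f"
  shows "f \<in> borel_measurable (boundary_measure \<Omega>)"
  unfolding boundary_measure_def
proof (rule measurable_restrict_space1)
  \<comment> \<open>Only the sigma-algebra matters for measurability, and \<open>measure_of\<close>
    fixes it independently of the set function supplied. Countable additivity of the Hausdorff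
    measure is therefore never invoked.\<close>
  have "sets (measure_of UNIV (sets borel) hausdorff_outer1) = sets borel"
    using sets.sets_measure_of_eq[of borel] by simp
  then show "f \<in> borel_measurable (measure_of UNIV (sets borel) hausdorff_outer1)"
    using borel_measurable_continuous_onI[OF assms] measurable_cong_sets by blast
qed

text \<open>The same combination of the two approximating smooth sequences approximates the combined
  function, its weak gradient and its trace simultaneously.\<close>

lemma has_trace_lincomb:
  assumes \<Omega>: "open \<Omega>" "bounded \<Omega>"
    and u: "u \<in> L2 (lebesgue_on \<Omega>)" "has_trace \<Omega> u s"
    and v: "v \<in> L2 (lebesgue_on \<Omega>)" "has_trace \<Omega> v t"
  shows "has_trace \<Omega> (\<lambda>x. c * u x + d * v x) (\<lambda>x. c * s x + d * t x)"
proof -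
  obtain \<phi> g where \<phi>: "\<And>n. smooth (\<phi> n)" "weak_gradient \<Omega> u g"
      "tendsto_L2 (lebesgue_on \<Omega>) \<phi> u"
      "tendsto_L2 (lebesgue_on \<Omega>) (\<lambda>n. grad (\<phi> n)) g"
      "tendsto_L2 (boundary_measure \<Omega>) \<phi> s" and s: "s \<in> L2 (boundary_measure \<Omega>)"
    using u unfolding has_trace_def by blast
  obtain \<psi> h where \<psi>: "\<And>n. smooth (\<psi> n)" "weak_gradient \<Omega> v h"
      "tendsto_L2 (lebesgue_on \<Omega>) \<psi> v"
      "tendsto_L2 (lebesgue_on \<Omega>) (\<lambda>n. grad (\<psi> n)) h"
      "tendsto_L2 (boundary_measure \<Omega>) \<psi> t" and t: "t \<in> L2 (boundary_measure \<Omega>)"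
    using v unfolding has_trace_def by blast
  have meas: "u \<in> borel_measurable (lebesgue_on \<Omega>)" "v \<in> borel_measurable (lebesgue_on \<Omega>)"
    "g \<in> borel_measurable (lebesgue_on \<Omega>)" "h \<in> borel_measurable (lebesgue_on \<Omega>)"
    "s \<in> borel_measurable (boundary_measure \<Omega>)" "t \<in> borel_measurable (boundary_measure \<Omega>)"
    using u v s t \<phi>(2) \<psi>(2) by (auto simp: L2_def weak_gradient_def)
  let ?\<chi> = "\<lambda>n x. c * \<phi> n x + d * \<psi> n x"
  have "\<forall>n. smooth (?\<chi> n)"
    by (simp add: smooth_lincomb \<phi> \<psi>)
  \<comment> \<open>Here \<open>g\<close> and \<open>h\<close> are the particular weak gradients to
    which the classical gradients of \<open>\<phi>\<close> and \<open>\<psi>\<close>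
    converge.\<close>
  moreover have "weak_gradient \<Omega> (\<lambda>x. c * u x + d * v x) (\<lambda>x. c *\<^sub>R g x + d *\<^sub>R h x)"
    using weak_gradient_lincomb[OF \<Omega> u(1) \<phi>(2) v(1) \<psi>(2)] .
  moreover have "tendsto_L2 (lebesgue_on \<Omega>) ?\<chi> (\<lambda>x. c * u x + d * v x)"
    using tendsto_L2_lincomb[OF _ _ meas(1,2) \<phi>(3) \<psi>(3), of c d]
    by (simp add: continuous_borel_measurable_lebesgue_on smooth_continuous \<phi>(1) \<psi>(1))
  moreover have "tendsto_L2 (lebesgue_on \<Omega>) (\<lambda>n. grad (?\<chi> n)) (\<lambda>x. c *\<^sub>R g x + d *\<^sub>R h x)"
    using tendsto_L2_lincomb[OF _ _ meas(3,4) \<phi>(4) \<psi>(4), of c d]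
    by (simp add: continuous_borel_measurable_lebesgue_on continuous_on_grad grad_lincomb
        \<phi>(1) \<psi>(1))
  moreover have "tendsto_L2 (boundary_measure \<Omega>) ?\<chi> (\<lambda>x. c * s x + d * t x)"
    using tendsto_L2_lincomb[OF _ _ meas(5,6) \<phi>(5) \<psi>(5), of c d]
    by (simp add: continuous_borel_measurable_boundary_measure smooth_continuous \<phi>(1) \<psi>(1))
  moreover have "(\<lambda>x. c * s x + d * t x) \<in> L2 (boundary_measure \<Omega>)"
    using L2_lincomb[OF s t, of c d] by simp
  ultimately show ?thesis
    unfolding has_trace_def
    by (intro conjI exI[of _ ?\<chi>] exI[of _ "\<lambda>x. c *\<^sub>R g x + d *\<^sub>R h x"])
qed

lemma state_space_lincomb:
  assumes \<Omega>: "open \<Omega>" "bounded \<Omega>"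
    and "u \<in> state_space \<Omega> \<Gamma>" "v \<in> state_space \<Omega> \<Gamma>"
  shows "(\<lambda>x. c * u x + d * v x) \<in> state_space \<Omega> \<Gamma>"
proof -
  obtain g s where u: "u \<in> L2 (lebesgue_on \<Omega>)" "weak_gradient \<Omega> u g" "has_trace \<Omega> u s"
    and s: "AE x in boundary_measure \<Omega>. x \<in> \<Gamma> \<longrightarrow> s x = 0"
    using assms by (auto simp: state_space_def H1_def)
  obtain h t where v: "v \<in> L2 (lebesgue_on \<Omega>)" "weak_gradient \<Omega> v h" "has_trace \<Omega> v t"
    and t: "AE x in boundary_measure \<Omega>. x \<in> \<Gamma> \<longrightarrow> t x = 0"
    using assms by (auto simp: state_space_def H1_def)
  have "(\<lambda>x. c * u x + d * v x) \<in> H1 \<Omega>"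
    using L2_lincomb[OF u(1) v(1), of c d] weak_gradient_lincomb[OF \<Omega> u(1,2) v(1,2)]
    by (auto simp: H1_def)
  moreover have "has_trace \<Omega> (\<lambda>x. c * u x + d * v x) (\<lambda>x. c * s x + d * t x)"
    using has_trace_lincomb[OF \<Omega> u(1,3) v(1,3)] .
  \<comment> \<open>The boundary condition is homogeneous, so it survives outside the union of the
    two exceptional null sets.\<close>
  moreover have "AE x in boundary_measure \<Omega>. x \<in> \<Gamma> \<longrightarrow> c * s x + d * t x = 0"
    using s t by eventually_elim auto
  ultimately show ?thesis
    unfolding state_space_def by blast
qed

section \<open>The Galerkin error\<close>

text \<open>The solution selected by \<open>SOME\<close> may differ from \<open>u\<close>, but both
  have the same load. The lemma is applied to the full space and to the finite element
  space.\<close>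

lemma cost_functional_eq:
  assumes "symmetric_form_on S (a k)" "variational_solution S (a k) l u"
  shows "cost_functional S a l k = l u"
proof -
  define w where "w = (SOME u. variational_solution S (a k) l u)"
  have "variational_solution S (a k) l w"
    unfolding w_def using someI[of _ u] assms(2) .
  \<comment> \<open>Each solution is a test function for the other: \<open>a k u w = l w\<close> and
    \<open>a k w u = l u\<close>, and symmetry equates the left sides.\<close>
  then have "l w = l u"
    using assms by (auto simp: symmetric_form_on_def variational_solution_def)
  then show ?thesis
    by (simp add: cost_functional_def w_def)
qed

text \<open>This is the purely algebraic core, for an arbitrary set \<open>S\<close> of functions;
  closure under subtraction therefore enters as the assumption that the error lies in
  \<open>S\<close>.\<close>

lemma galerkin_energy_identity:
  assumes b: "bilinear_form_on S b" "symmetric_form_on S b"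
    and "T \<subseteq> S" "(\<lambda>x. u x - w x) \<in> S"
    and u: "variational_solution S b l u" and w: "variational_solution T b l w"
  shows "b (\<lambda>x. u x - w x) (\<lambda>x. u x - w x) = l u - l w"
proof -
  let ?e = "\<lambda>x. u x - w x"
  have S: "u \<in> S" "w \<in> S"
    using assms by (auto simp: variational_solution_def)
  have left: "b ?e v = b u v - b w v" and right: "b v ?e = b v u - b v w" if "v \<in> S" for v
  proof -
    \<comment> \<open>The coefficients 1 and -1 are written out to match the shape required by
      \<open>linear_form_on\<close>.\<close>
    have "b (\<lambda>x. 1 * u x + (-1) * w x) v = 1 * b u v + (-1) * b w v"
      "b v (\<lambda>x. 1 * u x + (-1) * w x) = 1 * b v u + (-1) * b v w"
      using b(1) S that unfolding bilinear_form_on_def linear_form_on_def by blast+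
    then show "b ?e v = b u v - b w v" "b v ?e = b v u - b v w"
      by simp_all
  qed
  \<comment> \<open>The second equation tests the full problem with the discrete solution, which is
    allowed since \<open>T\<close> lies in \<open>S\<close>. With the last two it yields Galerkin
    orthogonality \<open>b w ?e = 0\<close>, so only \<open>b u ?e = l u - l w\<close>
    remains.\<close>
  have "b u u = l u" "b u w = l w" "b w w = l w" "b w u = b u w"
    using u w S b(2) by (auto simp: variational_solution_def symmetric_form_on_def)
  then show ?thesis
    using left[OF assms(4)] right[OF S(1)] right[OF S(2)] by simp
qed

theorem theorem1:
  fixes \<Omega> \<Gamma>u \<Gamma>n :: "point set"
    and \<gamma> V :: real
    and a :: "field2 \<Rightarrow> field2 \<Rightarrow> field2 \<Rightarrow> real"
    and l :: "field2 \<Rightarrow> real"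
    and Hh :: "field2 set"
    and k u uh :: field2
  defines "H \<equiv> state_space \<Omega> \<Gamma>u"
  defines "\<Phi> \<equiv> cost_functional H a l"
    and "\<Phi>h \<equiv> cost_functional Hh a l"
  assumes domain: "lipschitz_domain \<Omega>" "polygonal_boundary \<Omega>"
    and boundary: "frontier \<Omega> = closure (\<Gamma>u \<union> \<Gamma>n)" "\<Gamma>u \<inter> \<Gamma>n = {}"
    and gamma: "0 < \<gamma>" "\<gamma> < 1"
    and forms: "\<And>\<kappa>. \<kappa> \<in> admissible_designs \<Omega> \<gamma> V \<Longrightarrow>
        bilinear_form_on H (a \<kappa>) \<and> symmetric_form_on H (a \<kappa>) \<and>
        continuous_form_on \<Omega> H (a \<kappa>) \<and> coercive_form_on \<Omega> H (a \<kappa>)"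
    and load: "bounded_linear_form \<Omega> H l"
    and fe_space: "finite_dimensional_subspace \<Omega> H Hh"
    and design: "k \<in> admissible_designs \<Omega> \<gamma> V"
    and true_solution: "variational_solution H (a k) l u"
    and fe_solution: "variational_solution Hh (a k) l uh"
  shows "l u = l uh + (energy_norm (a k) (\<lambda>x. u x - uh x))\<^sup>2 \<and>
    \<Phi> k = \<Phi>h k + (energy_norm (a k) (\<lambda>x. u x - uh x))\<^sup>2"
  proof -
  have \<Omega>: "open \<Omega>" "bounded \<Omega>"
    using domain by (auto simp: lipschitz_domain_def)
  have form: "bilinear_form_on H (a k)" "symmetric_form_on H (a k)" "coercive_form_on \<Omega> H (a k)"
    using forms[OF design] by auto
  have sub: "Hh \<subseteq> H"
    using fe_space by (simp add: finite_dimensional_subspace_def)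
  let ?e = "\<lambda>x. u x - uh x"
  have "u \<in> H" "uh \<in> H"
    using true_solution fe_solution sub by (auto simp: variational_solution_def)
  then have e: "?e \<in> H"
    using state_space_lincomb[OF \<Omega>, of u \<Gamma>u uh 1 "-1"] by (simp add: H_def)
  obtain \<alpha> where "\<alpha> > 0" "\<alpha> * (H1_norm \<Omega> ?e)\<^sup>2 \<le> a k ?e ?e"
    using form(3) e by (auto simp: coercive_form_on_def)
  \<comment> \<open>Coercivity supplies the sign: without it, squaring the real \<open>sqrt\<close>
    in \<open>energy_norm\<close> would only give the absolute value.\<close>
  then have "0 \<le> a k ?e ?e"
    by (meson order_trans mult_nonneg_nonneg less_imp_le zero_le_power2)
  then have energy: "(energy_norm (a k) ?e)\<^sup>2 = l u - l uh"
    using galerkin_energy_identity[OF form(1,2) sub e true_solution fe_solution]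
    by (simp add: energy_norm_def)
  \<comment> \<open>Symmetry passes to the subspace, so the discrete cost is also independent of the
    chosen solution.\<close>
  have "symmetric_form_on Hh (a k)"
    using form(2) sub by (auto simp: symmetric_form_on_def)
  then have "\<Phi> k = l u" "\<Phi>h k = l uh"
    unfolding \<Phi>_def \<Phi>h_def
    using cost_functional_eq form(2) true_solution fe_solution by blast+
  then show ?thesis
    using energy by simp
qed

end
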